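(* Let $0\le t\le n$ and $1\le m\le n$ be integers, let $\mathbb{R}^n_t$ be $\mathbb{R}^n$ with the pseudo-Euclidean metric $\eta$ of signature $(-t,+(n-t))$, and let $u_1,\ldots,u_m$ be linearly independent vectors in $\mathbb{R}^n_t$. Let $\mathsf{lat}=\{\sum_{i=1}^m z_i u_i \mid z_i\in\mathbb{Z}\}$ and let $U$ be the $\mathbb{R}$-linear span of $\mathsf{lat}$. If the restriction $\eta|U$ of the metric $\eta$ to $U$ is positive-definite or negative-definite, then $eG_{\mathsf{lat}} = G_{\mathsf{lat}}$.
   Context: The metric $\eta$ is the standard nondegenerate symmetric bilinear form on $\mathbb{R}^n$ with $t$ negative and $n-t$ positive signs. $O(t,n-t)$ is the group of linear transformations of $\mathbb{R}^n$ preserving $\eta$. Definitions: $eG_{\mathsf{lat}}=\{R\in O(t,n-t)\mid R\,\mathsf{lat}\subset\mathsf{lat}\}$ (inclusion not necessarily proper), which is a semigroup under composition, and $G_{\mathsf{lat}}=\{R\in O(t,n-t)\mid R\,\mathsf{lat}=\mathsf{lat}\}$, which is a group. (They are the sets of pseudo-orthogonal parts $R$ of the elements $(t,R)$ of, respectively, the extended normalizer and the normalizer, in the isometry group of $\mathbb{R}^n_t$, of the group of translations by elements of $\mathsf{lat}$.) *)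

theory Defs
  imports "HOL-Analysis.Analysis"
begin

(* R^n is real^'n with n = CARD('n). As a finite index type carries no order, "the first t
   coordinates" is replaced by an arbitrary index set T of negative signs: the signature is
   (-card T, +(CARD('n) - card T)). *)
definition eta :: "'n::finite set \<Rightarrow> real ^ 'n \<Rightarrow> real ^ 'n \<Rightarrow> real" where
  "eta T x y = (\<Sum>i\<in>UNIV. (if i \<in> T then -1 else 1) * (x $ i) * (y $ i))"

(* Invertibility is not required separately: eta is nondegenerate, so a linear map preserving
   it is injective, hence bijective. *)
definition pseudo_orthogonal_group :: "'n::finite set \<Rightarrow> (real ^ 'n \<Rightarrow> real ^ 'n) set" where
  "pseudo_orthogonal_group T = {R. linear R \<and> (\<forall>x y. eta T (R x) (R y) = eta T x y)}"

definition lattice :: "nat \<Rightarrow> (nat \<Rightarrow> 'a::real_vector) \<Rightarrow> 'a set" where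
  "lattice m u = {(\<Sum>i=1..m. real_of_int (z i) *\<^sub>R u i) | z :: nat \<Rightarrow> int. True}"

(* The vectors are an indexed family, so independence includes distinctness. *)
definition independent_family :: "nat \<Rightarrow> (nat \<Rightarrow> 'a::real_vector) \<Rightarrow> bool" where
  "independent_family m u \<longleftrightarrow> inj_on u {1..m} \<and> independent (u ` {1..m})"

definition eG :: "'n::finite set \<Rightarrow> (real ^ 'n) set \<Rightarrow> (real ^ 'n \<Rightarrow> real ^ 'n) set" where
  "eG T L = {R \<in> pseudo_orthogonal_group T. R ` L \<subseteq> L}"

definition G :: "'n::finite set \<Rightarrow> (real ^ 'n) set \<Rightarrow> (real ^ 'n \<Rightarrow> real ^ 'n) set" where
  "G T L = {R \<in> pseudo_orthogonal_group T. R ` L = L}"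

definition positive_definite_on :: "'a::real_vector set \<Rightarrow> ('a \<Rightarrow> 'a \<Rightarrow> real) \<Rightarrow> bool" where
  "positive_definite_on U B \<longleftrightarrow> (\<forall>x\<in>U. x \<noteq> 0 \<longrightarrow> B x x > 0)"

definition negative_definite_on :: "'a::real_vector set \<Rightarrow> ('a \<Rightarrow> 'a \<Rightarrow> real) \<Rightarrow> bool" where
  "negative_definite_on U B \<longleftrightarrow> (\<forall>x\<in>U. x \<noteq> 0 \<longrightarrow> B x x < 0)"

end

theory Submission
  imports Defs
begin

text \<open>
  An element R of the semigroup preserves the definite quadratic form x \<mapsto> eta x x, so it is
  injective on the lattice and maps each set of lattice points on which the absolute value of the
  form is at most a given bound into itself. Definiteness makes these sets bounded, hence finite by
  discreteness of the lattice, and an injective self-map of a finite set is onto.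
\<close>

lemma eta_scaleR: "eta T (a *\<^sub>R x) (a *\<^sub>R x) = a\<^sup>2 * eta T x x"
  by (simp add: eta_def sum_distrib_left power2_eq_square ac_simps)

lemma continuous_on_eta: "continuous_on S (\<lambda>x. eta T x x)"
  unfolding eta_def by (intro continuous_intros)

text \<open>By compactness, \<bar>\<open>eta\<close>\<bar> attains a minimum on the unit sphere of
  \<open>U\<close>; the minimum is positive because the form has no nonzero null vector in
  \<open>U\<close>, and homogeneity of degree two carries the bound to all of \<open>U\<close>.
  Working with the absolute value treats both signs of definiteness at once.\<close>

lemma definite_eta_coercive:
  fixes T :: "'n::finite set"
  assumes U: "subspace U" and definite: "\<And>x. x \<in> U \<Longrightarrow> x \<noteq> 0 \<Longrightarrow> eta T x x \<noteq> 0"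
  obtains c where "c > 0" "\<And>x. x \<in> U \<Longrightarrow> c * (norm x)\<^sup>2 \<le> \<bar>eta T x x\<bar>"
proof (cases "U \<inter> sphere 0 1 = {}")
  case True
  \<comment> \<open>Here \<open>U\<close> is the zero subspace, so there is no minimum to take and
    any positive constant serves.\<close>
  have "x = 0" if "x \<in> U" for x
  proof (rule ccontr)
    assume "x \<noteq> 0"
    then have "x /\<^sub>R norm x \<in> U \<inter> sphere 0 1"
      using U that by (simp add: subspace_scale)
    with True show False by blast
  qed
  then have "1 * (norm x)\<^sup>2 \<le> \<bar>eta T x x\<bar>" if "x \<in> U" for x
    using that by fastforce
  then show thesis using that[of 1] by simp
next
  case False
  have "compact (U \<inter> sphere 0 1)"
    using U by (simp add: closed_Int_compact closed_subspace)
  moreover have "continuous_on (U \<inter> sphere 0 1) (\<lambda>x. \<bar>eta T x x\<bar>)"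
    by (intro continuous_intros continuous_on_eta)
  ultimately obtain s where s: "s \<in> U \<inter> sphere 0 1"
    and min: "\<And>y. y \<in> U \<inter> sphere 0 1 \<Longrightarrow> \<bar>eta T s s\<bar> \<le> \<bar>eta T y y\<bar>"
    using continuous_attains_inf[OF _ False] by blast
  have "\<bar>eta T s s\<bar> * (norm x)\<^sup>2 \<le> \<bar>eta T x x\<bar>" if "x \<in> U" for x
  proof (cases "x = 0")
    case False
    let ?y = "x /\<^sub>R norm x"
    have y: "?y \<in> U \<inter> sphere 0 1"
      using U that False by (simp add: subspace_scale)
    have "eta T x x = (norm x)\<^sup>2 * eta T ?y ?y"
      using eta_scaleR[of T "norm x" ?y] False by simp
    then have "\<bar>eta T x x\<bar> = \<bar>eta T ?y ?y\<bar> * (norm x)\<^sup>2"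
      by (simp add: abs_mult)
    then show ?thesis
      using mult_right_mono[OF min[OF y], of "(norm x)\<^sup>2"] by simp
  qed simp
  moreover have "\<bar>eta T s s\<bar> > 0"
    using definite[of s] s by (cases "s = 0") auto
  ultimately show thesis using that by blast
qed

text \<open>The coordinates with respect to \<open>u\<close> are linear functionals, hence bounded
  on \<open>S\<close>; on lattice points they are integers, which leaves finitely many choices for
  each.\<close>

lemma finite_lattice_Int_bounded:
  fixes u :: "nat \<Rightarrow> 'a::euclidean_space"
  assumes "independent_family m u" and "bounded S"
  shows "finite (lattice m u \<inter> S)"
proof -
  have inj: "inj_on u {1..m}" and ind: "independent (u ` {1..m})"
    using assms(1) by (auto simp: independent_family_def)
  \<comment> \<open>coordinate functionals extending the dual basis of \<open>u\<close>\<close>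
  have "\<exists>f. linear f \<and> (\<forall>j\<in>{1..m}. f (u j) = (if j = i then 1 else 0 :: real))"
    if i: "i \<in> {1..m}" for i
  proof -
    obtain f :: "'a \<Rightarrow> real" where "linear f"
      and "\<forall>x\<in>u ` {1..m}. f x = (if x = u i then 1 else 0)"
      using linear_independent_extend[OF ind, of "\<lambda>x. if x = u i then 1 else 0"] by blast
    then show ?thesis
      using inj i by (intro exI[of _ f]) (auto simp: inj_on_eq_iff)
  qed
  then obtain f where f: "\<And>i. i \<in> {1..m} \<Longrightarrow> linear (f i :: 'a \<Rightarrow> real)"
    and fu: "\<And>i j. i \<in> {1..m} \<Longrightarrow> j \<in> {1..m} \<Longrightarrow> f i (u j) = (if j = i then 1 else 0)"
    by metis
  have "\<exists>b. \<forall>x\<in>S. \<bar>f i x\<bar> \<le> b" if "i \<in> {1..m}" for i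
  proof -
    have "bounded (f i ` S)"
      using f[OF that] \<open>bounded S\<close> by (simp add: bounded_linear_image linear_conv_bounded_linear)
    then show ?thesis by (auto simp: bounded_iff)
  qed
  then obtain b where b: "\<And>i x. i \<in> {1..m} \<Longrightarrow> x \<in> S \<Longrightarrow> \<bar>f i x\<bar> \<le> b i"
    by metis
  let ?F = "\<Pi>\<^sub>E i\<in>{1..m}. {- \<lfloor>b i\<rfloor> .. \<lfloor>b i\<rfloor>}"
  let ?comb = "\<lambda>z. \<Sum>i=1..m. real_of_int (z i) *\<^sub>R u i"
  have "lattice m u \<inter> S \<subseteq> ?comb ` ?F"
  proof
    fix x assume x: "x \<in> lattice m u \<inter> S"
    then obtain z where z: "x = ?comb z"
      by (auto simp: lattice_def)
    have "z i \<in> {- \<lfloor>b i\<rfloor> .. \<lfloor>b i\<rfloor>}" if i: "i \<in> {1..m}" for i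
    proof -
      have "f i x = (\<Sum>j=1..m. real_of_int (z j) * f i (u j))"
        unfolding z using f[OF i] by (simp add: linear_sum linear_scale)
      also have "\<dots> = (\<Sum>j=1..m. if j = i then real_of_int (z j) else 0)"
        using fu[OF i] by (intro sum.cong) auto
      also have "\<dots> = real_of_int (z i)"
        using i by simp
      finally have "\<bar>real_of_int (z i)\<bar> \<le> b i"
        using b[OF i, of x] x by auto
      then have "\<bar>z i\<bar> \<le> \<lfloor>b i\<rfloor>"
        by (simp add: le_floor_iff)
      then show ?thesis by auto
    qed
    \<comment> \<open>The values of \<open>z\<close> outside \<open>{1..m}\<close> are arbitrary and
      do not enter the sum; fixing them by restriction places \<open>z\<close> in the finite set
      \<open>?F\<close> of extensional functions.\<close>
    then have "restrict z {1..m} \<in> ?F"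
      by auto
    moreover have "x = ?comb (restrict z {1..m})"
      unfolding z by (intro sum.cong) auto
    ultimately show "x \<in> ?comb ` ?F" by blast
  qed
  moreover have "finite ?F"
    by (intro finite_PiE) auto
  ultimately show ?thesis
    using finite_surj by blast
qed

theorem theoremA:
  fixes T :: "'n::finite set" and t m :: nat and u :: "nat \<Rightarrow> real ^ 'n"
  assumes "t \<le> CARD('n)" and "card T = t"
    and "1 \<le> m" and "m \<le> CARD('n)"
    and "independent_family m u"
    and "positive_definite_on (span (lattice m u)) (eta T) \<or>
         negative_definite_on (span (lattice m u)) (eta T)"
  shows "eG T (lattice m u) = G T (lattice m u)"
proof -
  let ?L = "lattice m u"
  have definite: "eta T x x \<noteq> 0" if "x \<in> span ?L" "x \<noteq> 0" for x
    using assms(6) that unfolding positive_definite_on_def negative_definite_on_def by force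
  obtain c where c: "c > 0" and coercive: "\<And>x. x \<in> span ?L \<Longrightarrow> c * (norm x)\<^sup>2 \<le> \<bar>eta T x x\<bar>"
    using definite_eta_coercive[OF subspace_span definite] by blast
  have finite_sublevel: "finite {x \<in> ?L. \<bar>eta T x x\<bar> \<le> r}" for r
  proof -
    \<comment> \<open>Coercivity turns the bound \<open>r\<close> on the form into a bound on the
      Euclidean norm.\<close>
    have "norm x \<le> sqrt (r / c)" if "x \<in> ?L" "\<bar>eta T x x\<bar> \<le> r" for x
    proof (rule real_le_rsqrt)
      have "c * (norm x)\<^sup>2 \<le> r"
        using coercive[OF span_base[OF that(1)]] that(2) by linarith
      then show "(norm x)\<^sup>2 \<le> r / c"
        using c by (simp add: field_simps)
    qed
    then have "{x \<in> ?L. \<bar>eta T x x\<bar> \<le> r} \<subseteq> ?L \<inter> cball 0 (sqrt (r / c))"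
      by auto
    then show ?thesis
      using finite_lattice_Int_bounded[OF assms(5) bounded_cball] finite_subset by blast
  qed
  have "?L \<subseteq> R ` ?L" if R: "R \<in> eG T ?L" for R
  proof
    fix x assume x: "x \<in> ?L"
    have "linear R" and eta_R: "\<And>x y. eta T (R x) (R y) = eta T x y" and RL: "R ` ?L \<subseteq> ?L"
      using R by (auto simp: eG_def pseudo_orthogonal_group_def)
    \<comment> \<open>The level is the value at \<open>x\<close> itself, so that \<open>x\<close>
      belongs to \<open>?S\<close>.\<close>
    let ?S = "{y \<in> ?L. \<bar>eta T y y\<bar> \<le> \<bar>eta T x x\<bar>}"
    have "inj_on R ?S"
    proof (rule inj_onI)
      fix v w assume vw: "v \<in> ?S" "w \<in> ?S" "R v = R w"
      then have "R (v - w) = 0"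
        using \<open>linear R\<close> by (simp add: linear_diff)
      then have "eta T (v - w) (v - w) = 0"
        using eta_R[of "v - w" "v - w"] by (simp add: eta_def)
      \<comment> \<open>The difference need not lie in \<open>?S\<close>, but definiteness holds on
        the whole span.\<close>
      moreover have "v - w \<in> span ?L"
        using vw by (simp add: span_base span_diff)
      ultimately show "v = w"
        using definite by force
    qed
    moreover have "R ` ?S \<subseteq> ?S"
      using RL eta_R by auto
    ultimately have "R ` ?S = ?S"
      using finite_sublevel by (intro endo_inj_surj)
    then show "x \<in> R ` ?L"
      using x by blast
  qed
  then show ?thesis
    by (auto simp: eG_def G_def)
qed

end
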